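(* Let $Q=(q(i,j))_{i,j\in\mathbb{Z}_+}$ be an ergodic generator with stationary distribution vector $\pi=(\pi(i))_{i\in\mathbb{Z}_+}$. For each $n\in\mathbb{Z}_+$ let ${}_{[n]}\alpha$ be a $1\times(n+1)$ probability vector, and set $${}_{[n]}\overline{Q}={}_{[n]}Q-({}_{[n]}Qe)\,{}_{[n]}\alpha,\qquad {}_{[n]}\overline{\pi}=\frac{{}_{[n]}\alpha(-{}_{[n]}Q)^{-1}}{{}_{[n]}\alpha(-{}_{[n]}Q)^{-1}e}.$$ Suppose there exist $b,b'\in(0,\infty)$, a column vector $v=(v(i))_{i\in\mathbb{Z}_+}$ with $v(i)\ge 1$ for all $i$, and a finite set $C\subset\mathbb{Z}_+$ such that: (1) $\sum_{j\in\mathbb{Z}_+}q(i,j)v(j)\le -|q(i,i)|-1+b\,1_{C}(i)$ for all $i\in\mathbb{Z}_+$; (2) $\sum_{j=0}^{n}[{}_{[n]}\overline{Q}]_{i,j}\,v(j)\le -|q(i,i)|-1+b'\,1_{C}(i)$ for all $n\in\mathbb{Z}_+$ and all $i\in\{0,1,\dots,n\}$; (3) $\lim_{n\to\infty}\sum_{j=0}^{n}[{}_{[n]}\overline{Q}]_{i,j}\,v(j)=\sum_{j\in\mathbb{Z}_+}q(i,j)v(j)$ for every $i\in\mathbb{Z}_+$; (4) $\displaystyle\sup_{i\in\mathbb{Z}_+\setminus C}\Big\{\sum_{j\in\mathbb{Z}_+\setminus C}\frac{q(i,j)}{|q(i,i)|+1}\,\max(v(j)-v(i),0)\Big\}<\infty$.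 Then $$\lim_{n\to\infty}\|{}_{[n]}\overline{\pi}-\pi\|=0 .$$
   Context: $\mathbb{Z}_+=\{0,1,2,\dots\}$. An ergodic generator is the infinitesimal generator ($Q$-matrix) $Q=(q(i,j))_{i,j\in\mathbb{Z}_+}$ of an ergodic (irreducible and positive recurrent, hence non-explosive) continuous-time Markov chain on $\mathbb{Z}_+$; thus $\sum_{j}q(i,j)=0$, $q(i,i)\in(-\infty,0)$ and $q(i,j)\ge 0$ for $j\ne i$. Its stationary distribution vector $\pi$ is the unique positive row vector with $\pi Q=0$ and $\pi e=1$, where $e$ is a column vector of ones of appropriate order. ${}_{[n]}Q=(q(i,j))_{0\le i,j\le n}$ is the $(n+1)\times(n+1)$ northwest-corner truncation of $Q$; it is nonsingular and $(-{}_{[n]}Q)^{-1}\ge O$. $1_C$ is the indicator function of $C$. For a row vector $x=(x(j))$, $\|x\|=\sum_j|x(j)|$; a finite vector is extended to one indexed by $\mathbb{Z}_+$ by appending zeros. *)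

theory Defs
  imports "HOL-Probability.Probability" "Jordan_Normal_Form.Gauss_Jordan_Elimination"
begin

no_notation Finite_Cartesian_Product.vec_nth (infixl "$" 90)

section \<open>Continuous-time Markov chains on the nonnegative integers\<close>

definition stable_conservative :: "(nat \<Rightarrow> nat \<Rightarrow> real) \<Rightarrow> bool" where
  "stable_conservative Q \<longleftrightarrow>
     (\<forall>i. Q i i < 0) \<and> (\<forall>i j. j \<noteq> i \<longrightarrow> 0 \<le> Q i j) \<and> (\<forall>i. (\<lambda>j. Q i j) sums 0)"

text \<open>
  A trajectory records the successive states visited together with the holding times in them.
  After the explosion time (the supremum of the jump times, if finite) the state is
  \<^term>\<open>None\<close>, i.e. the chain is the minimal one and explosion is not excluded a priori.
\<close>

type_synonym trajectory = "nat \<Rightarrow> nat \<times> real"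

definition visited :: "nat \<Rightarrow> trajectory \<Rightarrow> nat" where
  "visited n \<omega> = fst (\<omega> n)"

definition holding_time :: "nat \<Rightarrow> trajectory \<Rightarrow> real" where
  "holding_time n \<omega> = snd (\<omega> n)"

definition jump_time :: "nat \<Rightarrow> trajectory \<Rightarrow> real" where
  "jump_time n \<omega> = (\<Sum>k<n. holding_time k \<omega>)"

definition state_at :: "real \<Rightarrow> trajectory \<Rightarrow> nat option" where
  "state_at t \<omega> =
     (if \<exists>n. jump_time n \<omega> \<le> t \<and> t < jump_time (Suc n) \<omega>
      then Some (visited (THE n. jump_time n \<omega> \<le> t \<and> t < jump_time (Suc n) \<omega>) \<omega>)
      else None)"

definition jump_prob :: "(nat \<Rightarrow> nat \<Rightarrow> real) \<Rightarrow> nat \<Rightarrow> nat \<Rightarrow> real" where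
  "jump_prob Q i j = (if j = i then 0 else Q i j / \<bar>Q i i\<bar>)"

text \<open>
  \<open>P i\<close> is the law, started from \<open>i\<close>, of the continuous-time Markov chain with generator \<open>Q\<close>:
  the visited states form a discrete-time Markov chain with transition matrix
  \<^term>\<open>jump_prob Q\<close>, and, given these states, the holding times are independent and
  exponential with rates \<open>\<bar>Q x x\<bar>\<close>, \<open>x\<close> running through the visited states.
\<close>

definition is_ctmc :: "(nat \<Rightarrow> nat \<Rightarrow> real) \<Rightarrow> (nat \<Rightarrow> trajectory measure) \<Rightarrow> bool" where
  "is_ctmc Q P \<longleftrightarrow> (\<forall>i.
     prob_space (P i) \<and>
     (\<forall>n. visited n \<in> measurable (P i) (count_space UNIV)) \<and>
     (\<forall>n. holding_time n \<in> borel_measurable (P i)) \<and>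
     (\<forall>\<omega>\<in>space (P i). \<forall>n. 0 < holding_time n \<omega>) \<and>
     (\<forall>n x s. (\<forall>k\<le>n. 0 \<le> s k) \<longrightarrow>
        measure (P i) {\<omega> \<in> space (P i). \<forall>k\<le>n. visited k \<omega> = x k \<and> s k < holding_time k \<omega>} =
        (if x 0 = i then 1 else 0) * (\<Prod>k<n. jump_prob Q (x k) (x (Suc k))) *
        (\<Prod>k\<le>n. exp (- \<bar>Q (x k) (x k)\<bar> * s k))))"

definition irreducible_ctmc :: "(nat \<Rightarrow> trajectory measure) \<Rightarrow> bool" where
  "irreducible_ctmc P \<longleftrightarrow>
     (\<forall>i j. \<exists>t\<ge>0. 0 < measure (P i) {\<omega> \<in> space (P i). state_at t \<omega> = Some j})"

text \<open>The first time after the first jump at which the chain is in \<open>i\<close>; \<open>\<infinity>\<close> if there is none.\<close>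

definition return_time :: "nat \<Rightarrow> trajectory \<Rightarrow> ennreal" where
  "return_time i \<omega> =
     (INF t \<in> {t. jump_time 1 \<omega> \<le> t \<and> state_at t \<omega> = Some i}. ennreal t)"

definition positive_recurrent_ctmc :: "(nat \<Rightarrow> trajectory measure) \<Rightarrow> bool" where
  "positive_recurrent_ctmc P \<longleftrightarrow> (\<forall>i. (\<integral>\<^sup>+ \<omega>. return_time i \<omega> \<partial>P i) < \<infinity>)"

definition ergodic_generator :: "(nat \<Rightarrow> nat \<Rightarrow> real) \<Rightarrow> bool" where
  "ergodic_generator Q \<longleftrightarrow> stable_conservative Q \<and>
     (\<exists>P. is_ctmc Q P \<and> irreducible_ctmc P \<and> positive_recurrent_ctmc P)"

definition stationary_distribution :: "(nat \<Rightarrow> nat \<Rightarrow> real) \<Rightarrow> (nat \<Rightarrow> real) \<Rightarrow> bool" where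
  "stationary_distribution Q \<pi> \<longleftrightarrow>
     (\<forall>i. 0 < \<pi> i) \<and> (\<forall>j. (\<lambda>i. \<pi> i * Q i j) sums 0) \<and> \<pi> sums 1"

section \<open>Augmented northwest-corner truncations\<close>

definition ones :: "nat \<Rightarrow> real vec" where
  "ones m = vec m (\<lambda>_. 1)"

definition probability_vector :: "nat \<Rightarrow> real vec \<Rightarrow> bool" where
  "probability_vector m a \<longleftrightarrow>
     a \<in> carrier_vec m \<and> (\<forall>j<m. 0 \<le> a $ j) \<and> (\<Sum>j<m. a $ j) = 1"

definition truncation :: "(nat \<Rightarrow> nat \<Rightarrow> real) \<Rightarrow> nat \<Rightarrow> real mat" where
  "truncation Q n = mat (n + 1) (n + 1) (\<lambda>(i, j). Q i j)"

definition augmented_truncation ::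
    "(nat \<Rightarrow> nat \<Rightarrow> real) \<Rightarrow> (nat \<Rightarrow> real vec) \<Rightarrow> nat \<Rightarrow> real mat" where
  "augmented_truncation Q \<alpha> n = truncation Q n -
     mat_of_cols (n + 1) [truncation Q n *\<^sub>v ones (n + 1)] * mat_of_rows (n + 1) [\<alpha> n]"

text \<open>
  The row vector \<open>\<alpha> n (- truncation Q n)\<^sup>-\<^sup>1\<close>, with row vectors acting through the transpose.
  For an ergodic generator the truncation is nonsingular, so \<^const>\<open>the\<close> is not applied
  to \<^term>\<open>None\<close>.
\<close>

definition truncation_row :: "(nat \<Rightarrow> nat \<Rightarrow> real) \<Rightarrow> (nat \<Rightarrow> real vec) \<Rightarrow> nat \<Rightarrow> real vec" where
  "truncation_row Q \<alpha> n = transpose_mat (the (mat_inverse (- truncation Q n))) *\<^sub>v \<alpha> n"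

definition augmented_stationary ::
    "(nat \<Rightarrow> nat \<Rightarrow> real) \<Rightarrow> (nat \<Rightarrow> real vec) \<Rightarrow> nat \<Rightarrow> real vec" where
  "augmented_stationary Q \<alpha> n =
     (1 / (truncation_row Q \<alpha> n \<bullet> ones (n + 1))) \<cdot>\<^sub>v truncation_row Q \<alpha> n"

definition zero_extend :: "real vec \<Rightarrow> nat \<Rightarrow> real" where
  "zero_extend a j = (if j < dim_vec a then a $ j else 0)"

text \<open>Used only for absolutely summable \<open>x\<close>.\<close>

definition l1_norm :: "(nat \<Rightarrow> real) \<Rightarrow> real" where
  "l1_norm x = (\<Sum>j. \<bar>x j\<bar>)"

end

theory Submission
  imports Defs "Jordan_Normal_Form.Determinant"
begin

text \<open>
  Write \<open>p n\<close> for the stationary vector of the \<open>n\<close>-th augmented truncation. Pairing the truncated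
  drift condition with \<open>p n\<close> bounds \<open>\<Sum>i. p n i * \<bar>Q i i\<bar>\<close> and keeps a fixed amount of mass in \<open>C\<close>,
  so every pointwise cluster point \<open>\<mu>\<close> is a nonzero subinvariant measure of finite total flow, and
  hence \<open>\<mu> = c \<pi>\<close> with \<open>0 < c \<le> 1\<close>. To exclude loss of mass, apply Fatou's lemma to
  \<open>p n i * (b' * indicator C i - 1 - d n i)\<close>, where \<open>d n\<close> is the truncated drift and the series
  sums to \<open>b' * p n C - 1\<close>. Because \<open>\<pi> (Q v) = 0\<close>, which is where the condition on the increments
  of \<open>v\<close> enters, the limiting inequality reads \<open>b' * \<mu> C - c \<le> b' * \<mu> C - 1\<close>, that is \<open>c \<ge> 1\<close>.
\<close>

section \<open>Closed sets and subinvariant measures\<close>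

lemma has_sum_minus:
  fixes f g :: "'a \<Rightarrow> real"
  assumes "(f has_sum a) A" and "(g has_sum b) A"
  shows "((\<lambda>x. f x - g x) has_sum a - b) A"
  using has_sum_add[OF assms(1) has_sum_uminusI[OF assms(2)]] by simp

lemma is_ctmc_cylinder:
  assumes "is_ctmc Q P" and "\<And>k. k \<le> n \<Longrightarrow> 0 \<le> s k"
  shows "measure (P i) {\<omega> \<in> space (P i). \<forall>k\<le>n. visited k \<omega> = x k \<and> s k < holding_time k \<omega>} =
        (if x 0 = i then 1 else 0) * (\<Prod>k<n. jump_prob Q (x k) (x (Suc k))) *
        (\<Prod>k\<le>n. exp (- \<bar>Q (x k) (x k)\<bar> * s k))"
  using assms unfolding is_ctmc_def by blast

text \<open>A finite path that starts at \<open>i\<close> and ends outside \<open>A\<close> contains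
  a jump of rate zero, so its cylinder has probability zero. There are countably many finite paths,
  hence a state outside \<open>A\<close> would be occupied at time \<open>t\<close> with probability
  zero, against irreducibility.\<close>

lemma ergodic_generator_closed_set:
  assumes erg: "ergodic_generator Q" and "i \<in> A"
    and closed: "\<And>i j. i \<in> A \<Longrightarrow> 0 < Q i j \<Longrightarrow> j \<in> A"
  shows "k \<in> A"
proof (rule ccontr)
  assume k: "k \<notin> A"
  obtain P where ctmc: "is_ctmc Q P" and irr: "irreducible_ctmc P"
    using erg by (auto simp: ergodic_generator_def)
  have sc: "stable_conservative Q"
    using erg by (simp add: ergodic_generator_def)
  obtain t where t: "0 < measure (P i) {\<omega> \<in> space (P i). state_at t \<omega> = Some k}"
    using irr by (auto simp: irreducible_ctmc_def)
  interpret prob_space "P i"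
    using ctmc by (simp add: is_ctmc_def)
  have [measurable]: "visited n \<in> measurable (P i) (count_space UNIV)"
    "holding_time n \<in> borel_measurable (P i)" for n
    using ctmc by (simp_all add: is_ctmc_def)
  have hold: "0 < holding_time n \<omega>" if "\<omega> \<in> space (P i)" for n \<omega>
    using ctmc that by (simp add: is_ctmc_def)
  \<comment> \<open>Holding times are positive, so with thresholds \<open>0\<close> this is the
    event that the visited states begin with \<open>xs\<close>. For the empty list the last index is
    \<open>0\<close> and \<open>[] ! 0\<close> is unspecified; this is harmless, as the estimate
    below holds for any function of the index.\<close>
  define B where "B xs = {\<omega> \<in> space (P i). \<forall>l\<le>length xs - 1. visited l \<omega> = xs ! l \<and> 0 < holding_time l \<omega>}"
    for xs
  have B_sets: "B xs \<in> sets (P i)" for xs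
    unfolding B_def by measurable
  have B_null: "B xs \<in> null_sets (P i)" if last: "xs ! (length xs - 1) = k" for xs
  proof -
    define n where "n = length xs - 1"
    have "measure (P i) (B xs) = (if xs ! 0 = i then 1 else 0) *
        (\<Prod>l<n. jump_prob Q (xs ! l) (xs ! Suc l)) * (\<Prod>l\<le>n. exp (- \<bar>Q (xs ! l) (xs ! l)\<bar> * 0))"
      using is_ctmc_cylinder[OF ctmc, of n "\<lambda>_. 0" i "(!) xs"] unfolding B_def n_def by simp
    also have "\<dots> = 0"
    proof (cases "xs ! 0 = i")
      case True
      have "\<exists>l<n. xs ! l \<in> A \<and> xs ! Suc l \<notin> A"
      proof (rule ccontr)
        assume *: "\<not> ?thesis"
        have "xs ! l \<in> A" if "l \<le> n" for l
          using that by (induction l) (use * True \<open>i \<in> A\<close> in auto)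
        then show False using last k by (auto simp: n_def)
      qed
      then obtain l where l: "l < n" "xs ! l \<in> A" "xs ! Suc l \<notin> A" by blast
      then have "\<not> 0 < Q (xs ! l) (xs ! Suc l)" and ne: "xs ! Suc l \<noteq> xs ! l"
        using closed by auto
      then have "Q (xs ! l) (xs ! Suc l) = 0"
        using sc unfolding stable_conservative_def by (metis order_le_less)
      then have "jump_prob Q (xs ! l) (xs ! Suc l) = 0"
        by (simp add: jump_prob_def)
      then have "(\<Prod>l<n. jump_prob Q (xs ! l) (xs ! Suc l)) = 0"
        using l by (intro prod_zero) auto
      then show ?thesis by simp
    qed simp
    finally show ?thesis
      using B_sets by (auto simp: null_sets_def emeasure_eq_measure)
  qed
  have null: "(\<Union>xs\<in>{xs. xs ! (length xs - 1) = k}. B xs) \<in> null_sets (P i)"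
    by (intro null_sets_UN') (auto intro: B_null)
  have "{\<omega> \<in> space (P i). state_at t \<omega> = Some k} \<subseteq> (\<Union>xs\<in>{xs. xs ! (length xs - 1) = k}. B xs)"
  proof
    fix \<omega> assume \<omega>: "\<omega> \<in> {\<omega> \<in> space (P i). state_at t \<omega> = Some k}"
    then obtain n where n: "visited n \<omega> = k"
      by (auto simp: state_at_def split: if_splits)
    let ?xs = "map (\<lambda>l. visited l \<omega>) [0..<Suc n]"
    have "\<omega> \<in> B ?xs"
      using \<omega> hold by (auto simp: B_def le_imp_less_Suc nth_map_upt simp del: upt_Suc)
    moreover have "?xs ! (length ?xs - 1) = k"
      using n by (simp del: upt_Suc)
    ultimately show "\<omega> \<in> (\<Union>xs\<in>{xs. xs ! (length xs - 1) = k}. B xs)" by blast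
  qed
  then have "measure (P i) {\<omega> \<in> space (P i). state_at t \<omega> = Some k}
      \<le> measure (P i) (\<Union>xs\<in>{xs. xs ! (length xs - 1) = k}. B xs)"
    using null by (intro finite_measure_mono) auto
  also have "\<dots> = 0"
    using null by (simp add: null_sets_def measure_def)
  finally show False using t by simp
qed

text \<open>
  Splitting off the diagonal makes every remaining series have nonnegative terms, so the
  stationarity equation \<open>x Q = 0\<close> reads ``inflow equals outflow''.
\<close>

locale irreducible_generator =
  fixes Q :: "nat \<Rightarrow> nat \<Rightarrow> real"
  assumes stable_conservative: "stable_conservative Q"
    and closed_set: "\<And>A i k. i \<in> A \<Longrightarrow> (\<And>i j. i \<in> A \<Longrightarrow> 0 < Q i j \<Longrightarrow> j \<in> A) \<Longrightarrow> k \<in> A"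
begin

definition flow :: "nat \<Rightarrow> nat \<Rightarrow> real" where
  "flow i j = (if j = i then 0 else Q i j)"

definition rate :: "nat \<Rightarrow> real" where
  "rate i = - Q i i"

lemma rate_pos: "0 < rate i"
  using stable_conservative by (simp add: rate_def stable_conservative_def)

lemma flow_nonneg: "0 \<le> flow i j"
  using stable_conservative by (simp add: flow_def stable_conservative_def)

lemma Q_eq: "Q i j = flow i j - (if j = i then rate i else 0)"
  by (simp add: flow_def rate_def)

lemma flow_has_sum: "(flow i has_sum rate i) UNIV"
proof (rule sums_nonneg_imp_has_sum)
  have "(\<lambda>j. Q i j) sums 0"
    using stable_conservative by (simp add: stable_conservative_def)
  moreover have "(\<lambda>j. if j = i then rate i else 0) sums rate i"
    using sums_single[of i "\<lambda>_. rate i"] by simp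
  ultimately have "(\<lambda>j. Q i j + (if j = i then rate i else 0)) sums (0 + rate i)"
    by (rule sums_add)
  then show "flow i sums rate i"
    by (simp add: Q_eq)
qed (rule flow_nonneg)

lemma sum_flow_le_rate: "finite F \<Longrightarrow> sum (flow i) F \<le> rate i"
  using finite_sum_le_has_sum[OF flow_has_sum] flow_nonneg by auto

text \<open>Only the diagonal term of the column series can be negative. Moving it to the other side
  turns the ordered convergence of \<open>sums\<close> into the unconditional
  \<open>has_sum\<close>, which the interchanges of summation use.\<close>

lemma column_has_sum:
  assumes "(\<lambda>i. x i * Q i j) sums s" and "\<And>i. 0 \<le> x i"
  shows "((\<lambda>i. x i * flow i j) has_sum (s + x j * rate j)) UNIV"
proof (rule sums_nonneg_imp_has_sum)
  have "(\<lambda>i. if i = j then x j * rate j else 0) sums (x j * rate j)"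
    using sums_single[of j "\<lambda>_. x j * rate j"] by simp
  from sums_add[OF assms(1) this] show "(\<lambda>i. x i * flow i j) sums (s + x j * rate j)"
    by (rule back_subst[where P="\<lambda>f. f sums _"]) (auto simp: fun_eq_iff Q_eq algebra_simps)
qed (simp add: assms flow_nonneg)

lemma total_flow:
  assumes "\<And>i. 0 \<le> x i" and "(\<lambda>i. x i * rate i) summable_on UNIV"
  shows "(\<lambda>(i, j). x i * flow i j) summable_on UNIV"
  using summable_on_SigmaI[of UNIV "\<lambda>(i, j). x i * flow i j" "\<lambda>_. UNIV" "\<lambda>i. x i * rate i"] assms
  by (auto intro: has_sum_cmult_right flow_has_sum simp: flow_nonneg)

text \<open>The family \<open>x i * flow i j\<close> is summable over pairs; adding it by rows gives
  the outflow, adding it by columns gives the inflow.\<close>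

lemma inflow_has_sum_outflow:
  assumes x: "\<And>i. 0 \<le> x i" and out: "((\<lambda>i. x i * rate i) has_sum S) UNIV"
    and inflow: "\<And>j. ((\<lambda>i. x i * flow i j) has_sum y j) UNIV"
  shows "(y has_sum S) UNIV"
proof -
  have "(\<lambda>(i, j). x i * flow i j) summable_on UNIV"
    using total_flow x out by (auto simp: summable_on_def)
  then obtain T where T: "((\<lambda>(i, j). x i * flow i j) has_sum T) (UNIV \<times> UNIV)"
    by (auto simp: summable_on_def)
  have "((\<lambda>i. x i * rate i) has_sum T) UNIV"
    by (rule has_sum_SigmaD[OF T]) (auto intro: has_sum_cmult_right flow_has_sum)
  then have "T = S" using out has_sum_unique by blast
  have "(y has_sum T) UNIV"
    by (rule has_sum_SigmaD[OF T[THEN has_sum_swap[THEN iffD1]]]) (auto intro: inflow)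
  with \<open>T = S\<close> show ?thesis by simp
qed

text \<open>Total inflow and total outflow are finite and equal, so differences of one sign add up
  to zero and each of them vanishes. Both signs occur: cluster points are subinvariant, while the
  positive part in the proportionality argument is superinvariant.\<close>

lemma subinvariant_imp_invariant:
  assumes "\<And>i. 0 \<le> x i" and out: "(\<lambda>i. x i * rate i) summable_on UNIV"
    and "\<And>j. ((\<lambda>i. x i * flow i j) has_sum y j) UNIV"
    and le: "(\<forall>j. y j \<le> x j * rate j) \<or> (\<forall>j. x j * rate j \<le> y j)"
  shows "y j = x j * rate j"
proof -
  obtain S where S: "((\<lambda>i. x i * rate i) has_sum S) UNIV"
    using out by (auto simp: summable_on_def)
  have y: "(y has_sum S) UNIV"
    by (rule inflow_has_sum_outflow) (use assms S in auto)
  have *: "((\<lambda>j. x j * rate j - y j) has_sum S - S) UNIV" "((\<lambda>j. y j - x j * rate j) has_sum S - S) UNIV"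
    using has_sum_minus[OF S y] has_sum_minus[OF y S] by simp_all
  have "((\<lambda>j. \<bar>x j * rate j - y j\<bar>) has_sum 0) UNIV"
  proof (rule disjE[OF le])
    assume "\<forall>j. y j \<le> x j * rate j"
    with *(1) show ?thesis by simp
  next
    assume "\<forall>j. x j * rate j \<le> y j"
    with *(2) show ?thesis by (simp add: abs_minus_commute)
  qed
  from nonneg_has_sum_le_0D[OF this order_refl, of j] show ?thesis by simp
qed

text \<open>The support of \<open>x\<close> is closed: if \<open>x j = 0\<close>, the inflow into
  \<open>j\<close> is at most zero, so no state of the support feeds \<open>j\<close>. By
  irreducibility a nonempty support is everything.\<close>

lemma subinvariant_zero:
  assumes x: "\<And>i. 0 \<le> x i" and inflow: "\<And>j. ((\<lambda>i. x i * flow i j) has_sum y j) UNIV"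
    and le: "\<And>j. y j \<le> x j * rate j" and "x k = 0"
  shows "x i = 0"
proof (rule ccontr)
  assume "x i \<noteq> 0"
  have "x j \<noteq> 0" if "x l \<noteq> 0" "0 < Q l j" for l j
  proof
    assume "x j = 0"
    then have "y j \<le> 0" using le[of j] by simp
    have "x l * flow l j = 0"
      using nonneg_has_sum_le_0D[OF inflow \<open>y j \<le> 0\<close>, of l] x flow_nonneg by auto
    then show False using that \<open>x j = 0\<close> by (auto simp: flow_def split: if_splits)
  qed
  then have "k \<in> {j. x j \<noteq> 0}"
    using closed_set[of i "{j. x j \<noteq> 0}" k] \<open>x i \<noteq> 0\<close> by blast
  with \<open>x k = 0\<close> show False by simp
qed

text \<open>Choose \<open>k\<close> so that \<open>k * \<mu>\<close> and \<open>\<pi>\<close> agree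
  at \<open>0\<close>. The positive part of their difference is superinvariant with finite outflow,
  hence invariant; as it vanishes at \<open>0\<close>, it is zero. Then
  \<open>\<pi> - k * \<mu>\<close> is nonnegative, invariant and zero at \<open>0\<close>, hence
  zero as well.\<close>

lemma subinvariant_proportional:
  assumes pi: "\<And>i. 0 \<le> \<pi> i" and \<pi>Q: "\<And>j. (\<lambda>i. \<pi> i * Q i j) sums 0"
    and \<mu>: "\<And>i. 0 \<le> \<mu> i" and out: "(\<lambda>i. \<mu> i * rate i) summable_on UNIV"
    and inflow: "\<And>j. ((\<lambda>i. \<mu> i * flow i j) has_sum y j) UNIV"
    and le: "\<And>j. y j \<le> \<mu> j * rate j" and ne: "\<mu> m \<noteq> 0"
  shows "\<exists>k. 0 \<le> k \<and> (\<forall>i. \<pi> i = k * \<mu> i)"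
proof -
  have pos: "0 < \<mu> i" for i
    using subinvariant_zero[OF \<mu> inflow le, of i m] ne \<mu>[of i] by force
  define k where "k = \<pi> 0 / \<mu> 0"
  have k: "0 \<le> k" "k * \<mu> 0 = \<pi> 0"
    using pi[of 0] pos[of 0] by (auto simp: k_def)
  have y: "y j = \<mu> j * rate j" for j
    using subinvariant_imp_invariant[OF \<mu> out inflow] le by blast
  have \<pi>_in: "((\<lambda>i. \<pi> i * flow i j) has_sum \<pi> j * rate j) UNIV" for j
    using column_has_sum[OF \<pi>Q pi, of j] by simp
  have k\<mu>_in: "((\<lambda>i. k * \<mu> i * flow i j) has_sum k * \<mu> j * rate j) UNIV" for j
    using has_sum_cmult_right[OF inflow[of j], of k] by (simp add: y mult.assoc)
  \<comment> \<open>This sign of the difference is bounded by \<open>k * \<mu>\<close> and so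
    inherits finite outflow from \<open>\<mu>\<close>; for \<open>\<pi>\<close> finite outflow is
    not yet known.\<close>
  define N where "N i = max (k * \<mu> i - \<pi> i) 0" for i
  have N: "0 \<le> N i" "N i \<le> k * \<mu> i" for i
    using pi[of i] \<mu>[of i] k(1) by (auto simp: N_def)
  have N_sum: "(\<lambda>i. N i * flow i j) summable_on UNIV" for j
    by (rule summable_on_comparison_test[OF has_sum_imp_summable[OF k\<mu>_in[of j]]])
       (auto intro!: mult_right_mono N flow_nonneg mult_nonneg_nonneg)
  have N_out: "(\<lambda>i. N i * rate i) summable_on UNIV"
    by (rule summable_on_comparison_test[OF summable_on_cmult_right[OF out, of k]])
       (auto simp flip: mult.assoc intro!: mult_right_mono N mult_nonneg_nonneg less_imp_le[OF rate_pos])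
  define z where "z j = (\<Sum>\<^sub>\<infinity>i. N i * flow i j)" for j
  have z: "((\<lambda>i. N i * flow i j) has_sum z j) UNIV" for j
    using N_sum by (simp add: z_def)
  \<comment> \<open>\<open>N\<close> dominates both \<open>0\<close> and the invariant vector
    \<open>k * \<mu> - \<pi>\<close>, so its inflow dominates both \<open>0\<close> and the outflow
    of that vector.\<close>
  have "N j * rate j \<le> z j" for j
  proof (cases "k * \<mu> j \<le> \<pi> j")
    case True
    have "0 \<le> z j" using has_sum_nonneg[OF z] N flow_nonneg by auto
    with True show ?thesis by (simp add: N_def)
  next
    case False
    have "k * \<mu> j * rate j - \<pi> j * rate j \<le> z j"
      by (rule has_sum_mono[OF has_sum_minus[OF k\<mu>_in \<pi>_in] z])
         (auto simp flip: left_diff_distrib simp: N_def intro!: mult_right_mono flow_nonneg)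
    with False show ?thesis by (simp add: N_def left_diff_distrib)
  qed
  then have "z j = N j * rate j" for j
    using subinvariant_imp_invariant[OF N(1) N_out z] by blast
  then have "N i = 0" for i
    using subinvariant_zero[OF N(1) z, of 0] k by (simp add: N_def)
  then have ge: "0 \<le> \<pi> i - k * \<mu> i" for i
    by (metis N_def diff_le_0_iff_le diff_ge_0_iff_ge max.cobounded1)
  have "((\<lambda>i. (\<pi> i - k * \<mu> i) * flow i j) has_sum (\<pi> j - k * \<mu> j) * rate j) UNIV" for j
    using has_sum_minus[OF \<pi>_in k\<mu>_in] by (simp add: left_diff_distrib)
  from subinvariant_zero[OF ge this, of 0] have "\<pi> i - k * \<mu> i = 0" for i
    using k by simp
  with k show ?thesis by (intro exI[of _ k]) simp
qed

end

section \<open>Stationary vectors of augmented truncations\<close>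

context irreducible_generator
begin

text \<open>Let \<open>N\<close> collect the negative entries. Adding the columns in
  \<open>N\<close> gives a nonpositive sum of nonnegative terms, so all terms vanish; for a row in
  \<open>N\<close> this says that its whole rate flows into \<open>N\<close>. Thus \<open>N\<close>
  is closed but lies within the indices up to \<open>n\<close>, which irreducibility
  forbids.\<close>

lemma truncation_nonneg:
  assumes le: "\<And>j. j \<le> n \<Longrightarrow> (\<Sum>i\<le>n. x i * Q i j) \<le> 0" and "k \<le> n"
  shows "0 \<le> x k"
proof (rule ccontr)
  define N where "N = {i. i \<le> n \<and> x i < 0}"
  have fin: "finite N" by (simp add: N_def)
  assume "\<not> 0 \<le> x k"
  then have "k \<in> N" using \<open>k \<le> n\<close> by (simp add: N_def)
  have row: "(\<Sum>j\<in>N. Q i j) = (\<Sum>j\<in>N. flow i j) - (if i \<in> N then rate i else 0)" for i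
    using fin by (simp add: Q_eq sum_subtractf sum.delta)
  have term_nonneg: "0 \<le> x i * (\<Sum>j\<in>N. Q i j)" if "i \<le> n" for i
  proof (cases "i \<in> N")
    case True
    then have "(\<Sum>j\<in>N. Q i j) \<le> 0"
      using sum_flow_le_rate[OF fin, of i] by (simp add: row)
    then show ?thesis using True by (simp add: N_def mult_nonpos_nonpos)
  next
    case False
    then have "0 \<le> (\<Sum>j\<in>N. Q i j)"
      by (simp add: row sum_nonneg flow_nonneg)
    then show ?thesis using False that by (simp add: N_def)
  qed
  have "(\<Sum>i\<le>n. x i * (\<Sum>j\<in>N. Q i j)) = (\<Sum>j\<in>N. \<Sum>i\<le>n. x i * Q i j)"
    by (subst sum.swap) (simp add: sum_distrib_left)
  also have "\<dots> \<le> 0"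
    by (intro sum_nonpos le) (simp add: N_def)
  finally have "(\<Sum>i\<le>n. x i * (\<Sum>j\<in>N. Q i j)) = 0"
    using sum_nonneg[of "{..n}" "\<lambda>i. x i * (\<Sum>j\<in>N. Q i j)"] term_nonneg by force
  then have zero: "x i * (\<Sum>j\<in>N. Q i j) = 0" if "i \<le> n" for i
    using sum_nonneg_eq_0_iff[of "{..n}" "\<lambda>i. x i * (\<Sum>j\<in>N. Q i j)"] term_nonneg that by auto
  have "j \<in> N" if i: "i \<in> N" and pos: "0 < Q i j" for i j
  proof (rule ccontr)
    assume j: "j \<notin> N"
    have "x i \<noteq> 0" "i \<le> n" using i by (auto simp: N_def)
    with zero[of i] i have "(\<Sum>j\<in>N. flow i j) = rate i"
      by (simp add: row)
    moreover have "(\<Sum>j\<in>insert j N. flow i j) \<le> rate i"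
      using fin by (intro sum_flow_le_rate) simp
    moreover have "flow i j = Q i j" using i j by (auto simp: flow_def)
    ultimately show False using fin j pos by simp
  qed
  then have "Suc n \<in> N"
    using closed_set[of k N "Suc n"] \<open>k \<in> N\<close> by blast
  then show False by (simp add: N_def)
qed

text \<open>A zero determinant would give a nonzero left null vector \<open>w\<close>. The sign
  principle applies to both \<open>w\<close> and \<open>- w\<close>, which forces
  \<open>w = 0\<close>.\<close>

lemma truncation_inverse:
  obtains B where "mat_inverse (- truncation Q n) = Some B"
    and "B * (- truncation Q n) = 1\<^sub>m (n + 1)" and "B \<in> carrier_mat (n + 1) (n + 1)"
proof -
  define A where "A = - truncation Q n"
  have A: "A \<in> carrier_mat (n + 1) (n + 1)"
    by (simp add: A_def truncation_def)
  have "Determinant.det A \<noteq> 0"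
  proof
    assume "Determinant.det A = 0"
    then have "Determinant.det (transpose_mat A) = 0"
      using Determinant.det_transpose[OF A] by simp
    then obtain w where w: "w \<in> carrier_vec (n + 1)" "w \<noteq> 0\<^sub>v (n + 1)"
        and Aw: "transpose_mat A *\<^sub>v w = 0\<^sub>v (n + 1)"
      using det_0_iff_vec_prod_zero[of "transpose_mat A" "n + 1"] A by auto
    have col: "(\<Sum>i\<le>n. w $ i * Q i j) = 0" if "j \<le> n" for j
    proof -
      have "0 = (transpose_mat A *\<^sub>v w) $ j"
        using Aw that by simp
      also have "\<dots> = (\<Sum>i\<le>n. - (Q i j * w $ i))"
        using w A that
        by (simp add: scalar_prod_def A_def truncation_def lessThan_Suc_atMost[symmetric] atLeast0LessThan)
      finally show ?thesis by (simp add: sum_negf mult.commute)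
    qed
    have "0 \<le> w $ k" "0 \<le> - (w $ k)" if "k \<le> n" for k
      using truncation_nonneg[of n "\<lambda>i. w $ i" k] truncation_nonneg[of n "\<lambda>i. - (w $ i)" k] col that
      by (simp_all add: sum_negf)
    then have "w $ k = 0" if "k < n + 1" for k
      using that by (simp add: order_antisym)
    then have "w = 0\<^sub>v (n + 1)"
      using w(1) by (intro eq_vecI) auto
    with w show False by simp
  qed
  then have "A \<in> Units (ring_mat TYPE(real) (n + 1) ())"
    by (rule det_non_zero_imp_unit[OF A])
  then obtain B where "mat_inverse A = Some B"
    using mat_inverse(1)[OF A] by (metis option.exhaust)
  with mat_inverse(2)[OF A this] that show ?thesis
    by (simp add: A_def)
qed

text \<open>The unnormalised vector \<open>x\<close> solves the truncated equation with right-hand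
  side \<open>- \<alpha> n\<close>, is nonnegative by the sign principle, and is nonzero because
  \<open>\<alpha> n\<close> is. Dividing by its total \<open>T\<close> gives a probability vector,
  with \<open>s = 1 / T\<close>.\<close>

lemma augmented_stationary_equation:
  assumes \<alpha>: "probability_vector (n + 1) (\<alpha> n)"
  defines "p \<equiv> zero_extend (augmented_stationary Q \<alpha> n)"
  shows "0 \<le> p i" and "n < i \<Longrightarrow> p i = 0" and "(\<Sum>i\<le>n. p i) = 1"
    and "\<exists>s\<ge>0. \<forall>j\<le>n. (\<Sum>i\<le>n. p i * Q i j) = - (s * \<alpha> n $ j)"
proof -
  obtain B where B: "mat_inverse (- truncation Q n) = Some B"
      "B * (- truncation Q n) = 1\<^sub>m (n + 1)" "B \<in> carrier_mat (n + 1) (n + 1)"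
    by (rule truncation_inverse)
  have a: "\<alpha> n \<in> carrier_vec (n + 1)" "\<And>j. j \<le> n \<Longrightarrow> 0 \<le> \<alpha> n $ j" "(\<Sum>j\<le>n. \<alpha> n $ j) = 1"
    using \<alpha> by (auto simp: probability_vector_def lessThan_Suc_atMost less_Suc_eq_le)
  define A where "A = - truncation Q n"
  have A: "A \<in> carrier_mat (n + 1) (n + 1)"
    by (simp add: A_def truncation_def)
  define x where "x = truncation_row Q \<alpha> n"
  have x_eq: "x = transpose_mat B *\<^sub>v \<alpha> n"
    by (simp add: x_def truncation_row_def B)
  have x: "x \<in> carrier_vec (n + 1)"
    using B(3) by (simp add: x_eq carrier_vecI)
  have "transpose_mat A *\<^sub>v x = (transpose_mat A * transpose_mat B) *\<^sub>v \<alpha> n"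
    unfolding x_eq using A B(3) a(1) by (intro assoc_mult_mat_vec[symmetric]) auto
  also have "transpose_mat A * transpose_mat B = transpose_mat (B * A)"
    using A B(3) by (simp add: transpose_mult)
  also have "transpose_mat (B * A) *\<^sub>v \<alpha> n = \<alpha> n"
    using B(2) a(1) by (simp add: A_def)
  finally have Ax: "transpose_mat A *\<^sub>v x = \<alpha> n" .
  have col: "(\<Sum>i\<le>n. x $ i * Q i j) = - (\<alpha> n $ j)" if "j \<le> n" for j
  proof -
    have "\<alpha> n $ j = (\<Sum>i\<le>n. - (Q i j * x $ i))"
      unfolding Ax[symmetric] using x A that
      by (simp add: scalar_prod_def A_def truncation_def lessThan_Suc_atMost[symmetric] atLeast0LessThan)
    then show ?thesis by (simp add: sum_negf mult.commute)
  qed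
  have x_nonneg: "0 \<le> x $ k" if "k \<le> n" for k
    using truncation_nonneg[of n "\<lambda>i. x $ i" k] col a(2) that by simp
  define T where "T = (\<Sum>i\<le>n. x $ i)"
  have T: "x \<bullet> ones (n + 1) = T"
    by (simp add: scalar_prod_def ones_def T_def lessThan_Suc_atMost[symmetric] atLeast0LessThan)
  have "T \<noteq> 0"
  proof
    assume "T = 0"
    then have "x $ k = 0" if "k \<le> n" for k
      using sum_nonneg_eq_0_iff[of "{..n}" "\<lambda>i. x $ i"] x_nonneg that by (auto simp: T_def)
    then have "\<alpha> n $ j = 0" if "j \<le> n" for j
      using col[OF that] by simp
    then show False using a(3) by simp
  qed
  moreover have "0 \<le> T" unfolding T_def by (intro sum_nonneg x_nonneg) simp
  ultimately have "0 < T" by simp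
  have p_eq: "p i = (if i \<le> n then x $ i / T else 0)" for i
    using x unfolding p_def zero_extend_def augmented_stationary_def x_def[symmetric] T
    by (auto simp: less_Suc_eq_le)
  show "0 \<le> p i" and "n < i \<Longrightarrow> p i = 0"
    using \<open>0 < T\<close> x_nonneg by (auto simp: p_eq)
  show "(\<Sum>i\<le>n. p i) = 1"
    using \<open>0 < T\<close> by (simp add: p_eq T_def[symmetric] sum_divide_distrib[symmetric])
  have "(\<Sum>i\<le>n. p i * Q i j) = - (1 / T * \<alpha> n $ j)" if "j \<le> n" for j
    using col[OF that] by (simp add: p_eq sum_divide_distrib[symmetric])
  then show "\<exists>s\<ge>0. \<forall>j\<le>n. (\<Sum>i\<le>n. p i * Q i j) = - (s * \<alpha> n $ j)"
    using \<open>0 < T\<close> by (intro exI[of _ "1 / T"]) simp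
qed

end

lemma augmented_truncation_index:
  assumes "\<alpha> n \<in> carrier_vec (n + 1)" and "i \<le> n" and "j \<le> n"
  shows "augmented_truncation Q \<alpha> n $$ (i, j) = Q i j - (\<Sum>k\<le>n. Q i k) * \<alpha> n $ j"
  using assms
  by (simp add: augmented_truncation_def truncation_def ones_def mat_of_cols_def mat_of_rows_def
      scalar_prod_def lessThan_Suc_atMost[symmetric] atLeast0LessThan)

text \<open>Adding the equation over all columns shows that \<open>p\<close> pairs with the
  truncated row sums to \<open>- s\<close>. The rank-one correction thus contributes
  \<open>s * \<alpha> n $ j\<close> and cancels the right-hand side: the augmented truncation
  annihilates \<open>p\<close> from the left.\<close>

lemma augmented_balance:
  assumes \<alpha>: "probability_vector (n + 1) (\<alpha> n)"
    and eq: "\<And>j. j \<le> n \<Longrightarrow> (\<Sum>i\<le>n. p i * Q i j) = - (s * \<alpha> n $ j)"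
  shows "(\<Sum>i\<le>n. p i * (\<Sum>j=0..n. augmented_truncation Q \<alpha> n $$ (i, j) * v j)) = 0"
proof -
  have a: "\<alpha> n \<in> carrier_vec (n + 1)" "(\<Sum>j\<le>n. \<alpha> n $ j) = 1"
    using \<alpha> by (auto simp: probability_vector_def lessThan_Suc_atMost)
  have "(\<Sum>i\<le>n. p i * (\<Sum>k\<le>n. Q i k)) = (\<Sum>k\<le>n. \<Sum>i\<le>n. p i * Q i k)"
    by (subst sum.swap) (simp add: sum_distrib_left)
  also have "\<dots> = - s"
    using a(2) by (simp add: eq sum_negf sum_distrib_left[symmetric])
  finally have total: "(\<Sum>i\<le>n. p i * (\<Sum>k\<le>n. Q i k)) = - s" .
  have "(\<Sum>i\<le>n. p i * (\<Sum>j=0..n. augmented_truncation Q \<alpha> n $$ (i, j) * v j)) =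
      (\<Sum>i\<le>n. \<Sum>j\<le>n. (p i * Q i j - p i * (\<Sum>k\<le>n. Q i k) * \<alpha> n $ j) * v j)"
    unfolding sum_distrib_left[of "p _"] atLeast0AtMost
    by (intro sum.cong refl)
       (simp add: augmented_truncation_index[of \<alpha> n, OF a(1)] algebra_simps flip: sum_distrib_left)
  also have "\<dots> = (\<Sum>j\<le>n. \<Sum>i\<le>n. (p i * Q i j - p i * (\<Sum>k\<le>n. Q i k) * \<alpha> n $ j) * v j)"
    by (rule sum.swap)
  also have "\<dots> = (\<Sum>j\<le>n. ((\<Sum>i\<le>n. p i * Q i j) - (\<Sum>i\<le>n. p i * (\<Sum>k\<le>n. Q i k)) * \<alpha> n $ j) * v j)"
    by (simp add: sum_subtractf sum_distrib_right left_diff_distrib)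
  also have "\<dots> = 0"
    unfolding total by (simp add: eq)
  finally show ?thesis .
qed

section \<open>The mean drift under the stationary distribution\<close>

text \<open>A finite partial sum of \<open>f\<close> is one of \<open>f' K\<close> for a suitable
  \<open>K\<close>; it is at most the total of \<open>f' K\<close>, which equals that of
  \<open>g' K\<close> and is at most that of \<open>g\<close>.\<close>

lemma summable_on_cutoff:
  fixes f g :: "'a \<Rightarrow> real" and f' g' :: "real \<Rightarrow> 'a \<Rightarrow> real"
  assumes balance: "\<And>K. \<exists>T. (f' K has_sum T) UNIV \<and> (g' K has_sum T) UNIV"
    and f'_nonneg: "\<And>K z. 0 \<le> f' K z" and g'_le: "\<And>K z. g' K z \<le> g z"
    and f_eq: "\<And>F. finite F \<Longrightarrow> \<exists>K. \<forall>z\<in>F. f z = f' K z" and g: "g summable_on UNIV"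
  shows "f summable_on UNIV" and "infsum f UNIV \<le> infsum g UNIV"
proof -
  have le: "sum f F \<le> infsum g UNIV" if F: "finite F" for F
  proof -
    obtain K where K: "\<forall>z\<in>F. f z = f' K z" using f_eq[OF F] by blast
    obtain T where T: "(f' K has_sum T) UNIV" "(g' K has_sum T) UNIV" using balance by blast
    have "sum f F = sum (f' K) F" using K by simp
    also have "\<dots> \<le> T"
      using finite_sum_le_has_sum[OF T(1) F] f'_nonneg by auto
    also have "T \<le> infsum g UNIV"
      using has_sum_mono[OF T(2) has_sum_infsum[OF g]] g'_le by auto
    finally show ?thesis .
  qed
  have f_nonneg: "0 \<le> f z" for z
    using f_eq[of "{z}"] f'_nonneg by auto
  show "f summable_on UNIV"
    by (rule nonneg_bdd_above_summable_on) (auto intro!: bdd_aboveI[of _ "infsum g UNIV"] f_nonneg le)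
  then show "infsum f UNIV \<le> infsum g UNIV"
    by (rule infsum_le_finite_sums) (rule le)
qed

context irreducible_generator
begin

text \<open>For bounded \<open>u\<close> the flow weighted by \<open>u i\<close> and the flow
  weighted by \<open>u j\<close> are both summable, and stationarity makes their totals
  \<open>T1\<close> and \<open>T2\<close> equal. Their difference is the total upward minus the
  total downward increment.\<close>

lemma bounded_balance:
  assumes \<pi>: "\<And>i. 0 \<le> \<pi> i" "\<And>j. (\<lambda>i. \<pi> i * Q i j) sums 0" "(\<lambda>i. \<pi> i * rate i) summable_on UNIV"
    and u: "\<And>i. 0 \<le> u i" "\<And>i. u i \<le> K"
  shows "\<exists>T. ((\<lambda>(i, j). \<pi> i * flow i j * max (u j - u i) 0) has_sum T) UNIV \<and>
    ((\<lambda>(i, j). \<pi> i * flow i j * max (u i - u j) 0) has_sum T) UNIV"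
proof -
  have R: "(\<lambda>(i, j). \<pi> i * flow i j * K) summable_on UNIV"
    using summable_on_cmult_left[OF total_flow[OF \<pi>(1,3)], of K] by (simp add: case_prod_unfold)
  have sub: "(\<lambda>(i, j). \<pi> i * flow i j * h i j) summable_on UNIV" if "\<And>i j. 0 \<le> h i j \<and> h i j \<le> K" for h
    by (rule summable_on_comparison_test[OF R])
       (auto intro!: mult_left_mono mult_nonneg_nonneg \<pi> flow_nonneg that simp: that)
  have bounds: "0 \<le> max (u j - u i) 0 \<and> max (u j - u i) 0 \<le> K" for i j
    using u(1)[of i] u(2)[of j] u(1)[of j] by auto
  obtain T1 where T1: "((\<lambda>(i, j). \<pi> i * flow i j * u i) has_sum T1) (UNIV \<times> UNIV)"
    using sub[of "\<lambda>i j. u i"] u by (auto simp: summable_on_def)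
  obtain T2 where T2: "((\<lambda>(i, j). \<pi> i * flow i j * u j) has_sum T2) (UNIV \<times> UNIV)"
    using sub[of "\<lambda>i j. u j"] u by (auto simp: summable_on_def)
  have "((\<lambda>i. \<pi> i * rate i * u i) has_sum T1) UNIV"
    by (rule has_sum_SigmaD[OF T1]) (auto intro!: has_sum_cmult_right has_sum_cmult_left flow_has_sum)
  moreover have "((\<lambda>j. \<pi> j * rate j * u j) has_sum T2) UNIV"
    by (rule has_sum_SigmaD[OF T2[THEN has_sum_swap[THEN iffD1]]])
       (use column_has_sum[OF \<pi>(2,1)] in \<open>auto intro!: has_sum_cmult_left\<close>)
  ultimately have "T1 = T2" by (rule has_sum_unique)
  obtain S1 where S1: "((\<lambda>(i, j). \<pi> i * flow i j * max (u j - u i) 0) has_sum S1) UNIV"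
    using sub[of "\<lambda>i j. max (u j - u i) 0"] bounds by (auto simp: summable_on_def)
  obtain S2 where S2: "((\<lambda>(i, j). \<pi> i * flow i j * max (u i - u j) 0) has_sum S2) UNIV"
    using sub[of "\<lambda>i j. max (u i - u j) 0"] bounds by (auto simp: summable_on_def)
  have eq: "max (u j - u i) 0 - max (u i - u j) 0 = u j - u i" for i j
    by (simp add: max_def)
  have "((\<lambda>(i, j). \<pi> i * flow i j * (u j - u i)) has_sum S1 - S2) UNIV"
    using has_sum_minus[OF S1 S2]
    by (simp add: case_prod_unfold eq right_diff_distrib[symmetric])
  moreover have "((\<lambda>(i, j). \<pi> i * flow i j * (u j - u i)) has_sum T2 - T1) UNIV"
    using has_sum_minus[OF T2 T1] by (simp add: case_prod_unfold right_diff_distrib)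
  ultimately have "S1 - S2 = T2 - T1" by (rule has_sum_unique)
  with S1 S2 \<open>T1 = T2\<close> show ?thesis by auto
qed

lemma row_has_sum:
  assumes "summable (\<lambda>j. Q i j * v j)" and "\<And>j. 0 \<le> v j"
  shows "((\<lambda>j. flow i j * v j) has_sum ((\<Sum>j. Q i j * v j) + rate i * v i)) UNIV"
proof (rule sums_nonneg_imp_has_sum)
  have "(\<lambda>j. if j = i then rate i * v i else 0) sums (rate i * v i)"
    using sums_single[of i "\<lambda>_. rate i * v i"] by simp
  from sums_add[OF summable_sums[OF assms(1)] this]
  show "(\<lambda>j. flow i j * v j) sums ((\<Sum>j. Q i j * v j) + rate i * v i)"
    by (rule back_subst[where P="\<lambda>f. f sums _"]) (auto simp: fun_eq_iff Q_eq algebra_simps)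
qed (simp add: assms flow_nonneg)

text \<open>
  Formally \<open>\<pi> Q v = 0\<close> is \<open>(\<pi> Q) v = 0\<close>, but \<open>\<pi> v\<close> may be infinite.
  What makes the interchange legitimate is that the upward increments of \<open>v\<close> along the
  stationary flow are summable: cutting \<open>v\<close> off at level \<open>K\<close> shows that the downward
  increments have the same total.
\<close>

lemma stationary_drift_has_sum_zero:
  assumes \<pi>: "\<And>i. 0 \<le> \<pi> i" "\<And>j. (\<lambda>i. \<pi> i * Q i j) sums 0" "(\<lambda>i. \<pi> i * rate i) summable_on UNIV"
      "\<pi> summable_on UNIV"
    and v: "\<And>i. 0 \<le> v i" and Qv: "\<And>i. summable (\<lambda>j. Q i j * v j)" and "finite C" and "0 \<le> S"
    and incr: "\<And>i F. i \<notin> C \<Longrightarrow> finite F \<Longrightarrow> F \<subseteq> - C \<Longrightarrow>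
        (\<Sum>j\<in>F. flow i j * max (v j - v i) 0) \<le> S * (rate i + 1)"
  shows "((\<lambda>i. \<pi> i * (\<Sum>j. Q i j * v j)) has_sum 0) UNIV"
proof -
  define up where "up u = (\<lambda>(i, j). \<pi> i * flow i j * max (u j - u i) 0)" for u :: "nat \<Rightarrow> real"
  define down where "down u = (\<lambda>(i, j). \<pi> i * flow i j * max (u i - u j) 0)" for u :: "nat \<Rightarrow> real"
  define cut where "cut K i = min (v i) (max K 0)" for K i
  have balance: "\<exists>T. (up (cut K) has_sum T) UNIV \<and> (down (cut K) has_sum T) UNIV" for K
    unfolding up_def down_def
    by (rule bounded_balance[OF \<pi>(1-3), of _ "max K 0"]) (auto simp: cut_def v)
  have nonneg: "0 \<le> up u z" "0 \<le> down u z" for u z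
    by (auto simp: up_def down_def \<pi> flow_nonneg split: prod.split)
  \<comment> \<open>Cutting off is monotone and 1-Lipschitz, so it can only shrink increments of
    either sign.\<close>
  have cut_le: "up (cut K) z \<le> up v z" "down (cut K) z \<le> down v z" for K z
    by (auto simp: up_def down_def cut_def split: prod.split
        intro!: mult_left_mono mult_nonneg_nonneg \<pi> flow_nonneg)
  \<comment> \<open>The sum of \<open>v\<close> over all endpoints of pairs in \<open>F\<close> is a
    level that no value of \<open>v\<close> occurring there exceeds.\<close>
  have cut_eq: "\<exists>K. \<forall>z\<in>F. up v z = up (cut K) z \<and> down v z = down (cut K) z" if "finite F" for F
  proof -
    let ?I = "fst ` F \<union> snd ` F"
    have cut: "cut (sum v ?I) i = v i" if i: "i \<in> ?I" for i
    proof -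
      have "v i \<le> sum v ?I"
        by (rule member_le_sum[OF i]) (use v \<open>finite F\<close> in auto)
      then show ?thesis by (simp add: cut_def min_def max_def)
    qed
    have "up v (i, j) = up (cut (sum v ?I)) (i, j) \<and> down v (i, j) = down (cut (sum v ?I)) (i, j)"
      if "(i, j) \<in> F" for i j
      using cut[of i] cut[of j] image_eqI[OF _ that, of i fst] image_eqI[OF _ that, of j snd]
      by (simp add: up_def down_def)
    then have "\<forall>z\<in>F. up v z = up (cut (sum v ?I)) z \<and> down v z = down (cut (sum v ?I)) z"
      by (metis surj_pair)
    then show ?thesis by blast
  qed
  have row_summable: "(\<lambda>j. flow i j * max (v j - v i) 0) summable_on UNIV" for i
    by (rule summable_on_comparison_test[OF has_sum_imp_summable[OF row_has_sum[OF Qv v]]])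
       (auto intro!: mult_left_mono mult_nonneg_nonneg flow_nonneg simp: v)
  define w where "w i = (\<Sum>\<^sub>\<infinity>j. flow i j * max (v j - v i) 0)" for i
  define V where "V = (\<Sum>i\<in>C. v i)"
  have V: "0 \<le> V" "j \<in> C \<Longrightarrow> v j \<le> V" for j
    unfolding V_def by (auto intro!: sum_nonneg member_le_sum v \<open>finite C\<close>)
  have w_nonneg: "0 \<le> w i" for i
    unfolding w_def by (intro infsum_nonneg) (simp add: flow_nonneg)
  \<comment> \<open>The increment hypothesis covers targets outside \<open>C\<close>. A jump into
    \<open>C\<close> rises by at most \<open>V\<close>, and the total flow into \<open>C\<close> is
    at most \<open>rate i\<close>.\<close>
  have w_le: "w i \<le> S * (rate i + 1) + V * rate i" if "i \<notin> C" for i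
    unfolding w_def
  proof (rule infsum_le_finite_sums[OF row_summable])
    fix F :: "nat set" assume F: "finite F"
    have "(\<Sum>j\<in>F. flow i j * max (v j - v i) 0) =
        (\<Sum>j\<in>F - C. flow i j * max (v j - v i) 0) + (\<Sum>j\<in>F \<inter> C. flow i j * max (v j - v i) 0)"
      using sum.Int_Diff[OF F, of "\<lambda>j. flow i j * max (v j - v i) 0" C] by linarith
    also have "(\<Sum>j\<in>F \<inter> C. flow i j * max (v j - v i) 0) \<le> (\<Sum>j\<in>F \<inter> C. flow i j * V)"
    proof (intro sum_mono mult_left_mono flow_nonneg)
      fix j assume "j \<in> F \<inter> C"
      then have "v j \<le> V" by (intro V) simp
      then show "max (v j - v i) 0 \<le> V" using V(1) v[of i] by simp
    qed
    also have "\<dots> \<le> V * rate i"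
      using mult_left_mono[OF sum_flow_le_rate[of "F \<inter> C" i] V(1)] F
      by (simp add: sum_distrib_left mult.commute)
    also have "(\<Sum>j\<in>F - C. flow i j * max (v j - v i) 0) \<le> S * (rate i + 1)"
      using that F by (intro incr) auto
    finally show "(\<Sum>j\<in>F. flow i j * max (v j - v i) 0) \<le> S * (rate i + 1) + V * rate i"
      by simp
  qed
  have "(\<lambda>i. \<pi> i * w i) summable_on UNIV"
  proof (rule summable_on_comparison_test)
    show "(\<lambda>i. S * (\<pi> i * rate i + \<pi> i) + V * (\<pi> i * rate i) + (if i \<in> C then \<pi> i * w i else 0)) summable_on UNIV"
      using \<open>finite C\<close>
      by (intro summable_on_add summable_on_cmult_right \<pi> finite_nonzero_values_imp_summable_on) simp
    show "\<pi> i * w i \<le> S * (\<pi> i * rate i + \<pi> i) + V * (\<pi> i * rate i) + (if i \<in> C then \<pi> i * w i else 0)" for i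
    proof (cases "i \<in> C")
      case True
      then show ?thesis
        using \<open>0 \<le> S\<close> V(1) \<pi>(1)[of i] less_imp_le[OF rate_pos[of i]] by simp
    next
      case False
      from mult_left_mono[OF w_le[OF False] \<pi>(1)[of i]] False show ?thesis
        by (simp add: algebra_simps)
    qed
  qed (simp add: \<pi> w_nonneg)
  moreover have "((\<lambda>j. up v (i, j)) has_sum \<pi> i * w i) UNIV" for i
    using has_sum_cmult_right[OF has_sum_infsum[OF row_summable[of i]], of "\<pi> i"]
    by (simp add: up_def w_def mult.assoc)
  ultimately have "up v summable_on UNIV \<times> UNIV"
    by (intro summable_on_SigmaI[of UNIV "up v" "\<lambda>_. UNIV" "\<lambda>i. \<pi> i * w i"] nonneg)
  then have up: "up v summable_on UNIV" by simp
  have balance': "\<exists>T. (down (cut K) has_sum T) UNIV \<and> (up (cut K) has_sum T) UNIV" for K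
    using balance by blast
  have up_eq: "\<exists>K. \<forall>z\<in>F. up v z = up (cut K) z"
    and down_eq: "\<exists>K. \<forall>z\<in>F. down v z = down (cut K) z" if "finite F" for F
    using cut_eq[OF that] by blast+
  \<comment> \<open>Summability passes from upward to downward increments, with a total that is no
    larger; the second use, with the roles exchanged, gives the reverse inequality.\<close>
  note down = summable_on_cutoff[where f' = "\<lambda>K. down (cut K)" and g' = "\<lambda>K. up (cut K)",
      OF balance' nonneg(2) cut_le(1) down_eq up]
  have "infsum (up v) UNIV \<le> infsum (down v) UNIV"
    by (rule summable_on_cutoff(2)[where f' = "\<lambda>K. up (cut K)" and g' = "\<lambda>K. down (cut K)",
          OF balance nonneg(1) cut_le(2) up_eq down(1)])
  with down(2) has_sum_minus[OF has_sum_infsum[OF up] has_sum_infsum[OF down(1)]]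
  have "((\<lambda>z. up v z - down v z) has_sum 0) (UNIV \<times> UNIV)"
    by simp
  \<comment> \<open>For fixed \<open>i\<close> the two parts recombine to the increment
    \<open>v j - v i\<close>, and \<open>flow i\<close> has total \<open>rate i\<close>, so the row
    sum is \<open>\<pi> i\<close> times the drift at \<open>i\<close>.\<close>
  moreover have "((\<lambda>j. up v (i, j) - down v (i, j)) has_sum \<pi> i * (\<Sum>j. Q i j * v j)) UNIV" for i
  proof -
    have "((\<lambda>j. flow i j * v j - flow i j * v i) has_sum
        (\<Sum>j. Q i j * v j) + rate i * v i - rate i * v i) UNIV"
      by (intro has_sum_minus row_has_sum Qv v has_sum_cmult_left flow_has_sum)
    then have "((\<lambda>j. \<pi> i * (flow i j * v j - flow i j * v i)) has_sum \<pi> i * (\<Sum>j. Q i j * v j)) UNIV"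
      by (intro has_sum_cmult_right) simp
    moreover have "up v (i, j) - down v (i, j) = \<pi> i * (flow i j * v j - flow i j * v i)" for j
      by (simp add: up_def down_def max_def algebra_simps)
    ultimately show ?thesis by simp
  qed
  ultimately show ?thesis
    by (rule has_sum_SigmaD)
qed

end

section \<open>Convergence of the stationary vectors\<close>

text \<open>Limits pass through finite sums, and for nonnegative terms bounded finite sums suffice.
  The bound is asked only eventually because the inflow inequality at \<open>j\<close> is available
  once the truncation contains \<open>j\<close>.\<close>

lemma infsum_Fatou:
  fixes a :: "nat \<Rightarrow> 'a \<Rightarrow> real"
  assumes nonneg: "\<And>n i. 0 \<le> a n i" and lim: "\<And>i. (\<lambda>n. a n i) \<longlonglongrightarrow> l i"
    and bound: "\<And>F. finite F \<Longrightarrow> \<forall>\<^sub>F n in sequentially. sum (a n) F \<le> B n" and "B \<longlonglongrightarrow> L"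
  shows "l summable_on UNIV" and "infsum l UNIV \<le> L"
proof -
  have l: "0 \<le> l i" for i
    by (rule LIMSEQ_le_const[OF lim]) (auto intro: nonneg)
  have le: "sum l F \<le> L" if "finite F" for F
  proof (rule tendsto_le[OF sequentially_bot \<open>B \<longlonglongrightarrow> L\<close> _ bound[OF that]])
    show "(\<lambda>n. sum (a n) F) \<longlonglongrightarrow> sum l F"
      by (intro tendsto_sum lim)
  qed
  show "l summable_on UNIV"
    by (rule nonneg_bdd_above_summable_on) (auto intro!: bdd_aboveI[of _ L] l le)
  then show "infsum l UNIV \<le> L"
    by (rule infsum_le_finite_sums) (rule le)
qed

text \<open>Diagonal extraction, each coordinate lying in the compact interval from \<open>0\<close>
  to \<open>1\<close>.\<close>

lemma pointwise_convergent_subsequence: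
  fixes X :: "nat \<Rightarrow> nat \<Rightarrow> real"
  assumes "\<And>n i. X n i \<in> {0..1}"
  obtains r \<mu> where "strict_mono r" and "\<And>i. (\<lambda>n. X (r n) i) \<longlonglongrightarrow> \<mu> i"
proof -
  interpret subseqs "\<lambda>i s. convergent (\<lambda>n. X (s n) i)"
  proof
    fix i and s :: "nat \<Rightarrow> nat"
    have "seq_compact {0..1::real}" by (simp add: compact_imp_seq_compact)
    moreover have "\<forall>n. X (s n) i \<in> {0..1}" using assms by blast
    ultimately obtain l r where "strict_mono r" "((\<lambda>n. X (s n) i) \<circ> r) \<longlonglongrightarrow> l"
      by (rule seq_compactE)
    then show "\<exists>r'. strict_mono r' \<and> convergent (\<lambda>n. X ((s \<circ> r') n) i)"
      by (auto simp: convergent_def o_def)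
  qed
  \<comment> \<open>Past its first \<open>Suc i\<close> terms the diagonal sequence is a subsequence
    of the extraction for coordinate \<open>i\<close>.\<close>
  have "convergent (\<lambda>n. X ((diagseq \<circ> (+) (Suc i)) n) i)" for i
    by (rule diagseq_holds) (use LIMSEQ_subseq_LIMSEQ in \<open>fastforce simp: convergent_def o_def\<close>)
  then have "convergent (\<lambda>n. X (diagseq (n + Suc i)) i)" for i
    by (simp add: o_def add.commute[of _ i])
  then have "convergent (\<lambda>n. X (diagseq n) i)" for i
    using convergent_ignore_initial_segment[of "\<lambda>n. X (diagseq n) i" "Suc i"] by simp
  then have "\<forall>i. \<exists>l. (\<lambda>n. X (diagseq n) i) \<longlonglongrightarrow> l"
    by (simp add: convergent_def)
  then obtain \<mu> where "\<And>i. (\<lambda>n. X (diagseq n) i) \<longlonglongrightarrow> \<mu> i" by metis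
  with subseq_diagseq show ?thesis by (rule that)
qed

text \<open>The absolute difference is \<open>p n k - \<pi> k\<close> plus twice
  \<open>max (\<pi> k - p n k) 0\<close>. The first part sums to zero because both masses are one;
  the second is dominated by \<open>\<pi> k\<close>, so its sum tends to zero.\<close>

lemma Scheffe_l1:
  assumes \<pi>: "\<And>k. 0 \<le> \<pi> k" "\<pi> sums 1" and p: "\<And>n k. 0 \<le> p n k" "\<And>n. p n sums 1"
    and lim: "\<And>k. (\<lambda>n. p n k) \<longlonglongrightarrow> \<pi> k"
  shows "(\<lambda>n. l1_norm (\<lambda>k. p n k - \<pi> k)) \<longlonglongrightarrow> 0"
proof -
  have norm_le: "norm (max (\<pi> k - p n k) 0) \<le> \<pi> k" for n k
    using p(1)[of n k] \<pi>(1)[of k] by simp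
  have "(\<lambda>n. max (\<pi> k - p n k) 0) \<longlonglongrightarrow> max (\<pi> k - \<pi> k) 0" for k
    by (intro tendsto_intros lim)
  then have "(\<lambda>n. max (\<pi> k - p n k) 0) \<longlonglongrightarrow> 0" for k by simp
  from tannerys_theorem[OF this always_eventually sums_summable[OF \<pi>(2)]]
  have "(\<lambda>n. \<Sum>k. max (\<pi> k - p n k) 0) \<longlonglongrightarrow> 0"
    using norm_le by auto
  then have "(\<lambda>n. 2 * (\<Sum>k. max (\<pi> k - p n k) 0)) \<longlonglongrightarrow> 2 * 0"
    by (rule tendsto_mult_left)
  moreover have "l1_norm (\<lambda>k. p n k - \<pi> k) = 2 * (\<Sum>k. max (\<pi> k - p n k) 0)" for n
  proof -
    have "summable (\<lambda>k. max (\<pi> k - p n k) 0)"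
      by (rule summable_comparison_test[OF _ sums_summable[OF \<pi>(2)]]) (use norm_le in blast)
    then have "(\<lambda>k. 2 * max (\<pi> k - p n k) 0) sums (2 * (\<Sum>k. max (\<pi> k - p n k) 0))"
      by (intro sums_mult summable_sums)
    from sums_add[OF sums_diff[OF p(2)[of n] \<pi>(2)] this]
    have "(\<lambda>k. p n k - \<pi> k + 2 * max (\<pi> k - p n k) 0) sums (2 * (\<Sum>k. max (\<pi> k - p n k) 0))"
      by simp
    moreover have "p n k - \<pi> k + 2 * max (\<pi> k - p n k) 0 = \<bar>p n k - \<pi> k\<bar>" for k
      by (simp add: max_def)
    ultimately show ?thesis by (simp add: l1_norm_def sums_unique[symmetric])
  qed
  ultimately show ?thesis by simp
qed

theorem theorem2p1:
  fixes Q :: "nat \<Rightarrow> nat \<Rightarrow> real" and \<pi> :: "nat \<Rightarrow> real" and \<alpha> :: "nat \<Rightarrow> real vec"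
    and b b' :: real and v :: "nat \<Rightarrow> real" and C :: "nat set"
  assumes "ergodic_generator Q"
    and "stationary_distribution Q \<pi>"
    and "\<And>n. probability_vector (n + 1) (\<alpha> n)"
    and "0 < b" and "0 < b'"
    and "\<And>i. 1 \<le> v i"
    and "finite C"
    and drift: "\<And>i. summable (\<lambda>j. Q i j * v j) \<and>
          (\<Sum>j. Q i j * v j) \<le> - \<bar>Q i i\<bar> - 1 + b * indicator C i"
    and drift_trunc: "\<And>n i. i \<le> n \<Longrightarrow>
          (\<Sum>j = 0..n. augmented_truncation Q \<alpha> n $$ (i, j) * v j)
            \<le> - \<bar>Q i i\<bar> - 1 + b' * indicator C i"
    and drift_lim: "\<And>i. (\<lambda>n. \<Sum>j = 0..n. augmented_truncation Q \<alpha> n $$ (i, j) * v j)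
          \<longlonglongrightarrow> (\<Sum>j. Q i j * v j)"
    and increments: "(SUP i \<in> - C. \<Sum>\<^sub>\<infinity>j \<in> - C.
          ennreal (Q i j / (\<bar>Q i i\<bar> + 1) * max (v j - v i) 0)) < \<infinity>"
  shows "(\<lambda>n. l1_norm (\<lambda>j. zero_extend (augmented_stationary Q \<alpha> n) j - \<pi> j)) \<longlonglongrightarrow> 0"
proof -
  interpret irreducible_generator Q
  proof
    show "stable_conservative Q"
      using assms(1) by (simp add: ergodic_generator_def)
    show "k \<in> A" if "i \<in> A" "\<And>i j. i \<in> A \<Longrightarrow> 0 < Q i j \<Longrightarrow> j \<in> A" for A i k
      by (rule ergodic_generator_closed_set[OF assms(1) that(1)]) (rule that(2))
  qed
  have \<pi>: "0 < \<pi> i" "(\<lambda>i. \<pi> i * Q i j) sums 0" "\<pi> sums 1" for i j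
    using assms(2) by (simp_all add: stationary_distribution_def)
  have \<pi>_nonneg: "0 \<le> \<pi> i" for i
    using \<pi>(1) less_imp_le by blast
  have \<pi>_has_sum: "(\<pi> has_sum 1) UNIV"
    by (rule sums_nonneg_imp_has_sum[OF \<pi>(3) \<pi>_nonneg])
  have abs_Q: "\<bar>Q i i\<bar> = rate i" for i
    using rate_pos[of i] by (simp add: rate_def)

  \<comment> \<open>Mass and inflow of the truncated stationary vectors\<close>
  define p where "p n = zero_extend (augmented_stationary Q \<alpha> n)" for n
  have p: "0 \<le> p n i" "n < i \<Longrightarrow> p n i = 0" "(\<Sum>i\<le>n. p n i) = 1"
      "\<exists>s\<ge>0. \<forall>j\<le>n. (\<Sum>i\<le>n. p n i * Q i j) = - (s * \<alpha> n $ j)" for n i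
    using augmented_stationary_equation[of n \<alpha>, OF assms(3)] unfolding p_def by blast+
  have sum_le: "sum f F \<le> (\<Sum>i\<le>n. f i)"
    if "finite F" "\<And>i. 0 \<le> f i" "\<And>i. n < i \<Longrightarrow> f i = 0" for f :: "nat \<Rightarrow> real" and F n
  proof -
    have "sum f F \<le> sum f (F \<union> {..n})"
      using that by (intro sum_mono2) auto
    also have "\<dots> = (\<Sum>i\<le>n. f i)"
      using that by (intro sum.mono_neutral_right) auto
    finally show ?thesis .
  qed
  have p_sums: "p n sums 1" for n
    using sums_finite[of "{..n}" "p n"] p(2,3)[of n] by simp
  have p_sum_le: "sum (p n) F \<le> 1" if "finite F" for F n
    using sum_le[OF that, of "p n" n] p(1-3) by simp
  have p_le: "p n i \<le> 1" for n i
    using p_sum_le[of "{i}" n] by simp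
  \<comment> \<open>Column \<open>j\<close> of the truncated equation has the nonpositive value
    \<open>- (s * \<alpha> n $ j)\<close>: without the augmentation, inflow does not exceed
    outflow.\<close>
  have inflow_le: "(\<Sum>i\<in>F. p n i * flow i j) \<le> p n j * rate j" if "finite F" "j \<le> n" for F n j
  proof -
    obtain s where s: "0 \<le> s" "(\<Sum>i\<le>n. p n i * Q i j) = - (s * \<alpha> n $ j)"
      using p(4)[of n] \<open>j \<le> n\<close> by blast
    have "0 \<le> \<alpha> n $ j"
      using assms(3)[of n] \<open>j \<le> n\<close> by (simp add: probability_vector_def)
    have "(\<Sum>i\<in>F. p n i * flow i j) \<le> (\<Sum>i\<le>n. p n i * flow i j)"
      by (rule sum_le) (simp_all add: that p flow_nonneg)
    also have "\<dots> = (\<Sum>i\<le>n. p n i * Q i j + (if i = j then p n j * rate j else 0))"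
      by (intro sum.cong refl) (auto simp: Q_eq algebra_simps)
    also have "\<dots> = - (s * \<alpha> n $ j) + p n j * rate j"
      using \<open>j \<le> n\<close> by (simp add: sum.distrib s(2))
    also have "\<dots> \<le> p n j * rate j"
      using s(1) \<open>0 \<le> \<alpha> n $ j\<close> by simp
    finally show ?thesis .
  qed

  \<comment> \<open>Slack in the truncated drift condition\<close>
  define g where "g i = (\<Sum>j. Q i j * v j)" for i
  define d where "d n i = (\<Sum>j=0..n. augmented_truncation Q \<alpha> n $$ (i, j) * v j)" for n i
  \<comment> \<open>The truncated drift condition bounds the bracket below by \<open>rate i\<close>
    for \<open>i \<le> n\<close>. For larger \<open>i\<close> the matrix index in
    \<open>d n i\<close> is out of range, but there \<open>p n i = 0\<close>.\<close>
  define h where "h n i = p n i * (b' * indicator C i - 1 - d n i)" for n i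
  have h_ge: "p n i * rate i \<le> h n i" for n i
  proof (cases "i \<le> n")
    case True
    then show ?thesis
      unfolding h_def using drift_trunc[OF True] p(1) by (intro mult_left_mono) (simp_all add: abs_Q d_def)
  qed (simp add: h_def p)
  have h_nonneg: "0 \<le> h n i" for n i
    using h_ge[of n i] p(1)[of n i] less_imp_le[OF rate_pos[of i]] mult_nonneg_nonneg order_trans by blast
  \<comment> \<open>The drift terms cancel by the augmented balance, and the unit mass of
    \<open>p n\<close> leaves the \<open>- 1\<close>.\<close>
  have h_total: "(\<Sum>i\<le>n. h n i) = b' * (\<Sum>i\<in>C. p n i) - 1" for n
  proof -
    have "(\<Sum>i\<in>C. p n i) = (\<Sum>i\<in>{..n} \<inter> C. p n i)"
      using \<open>finite C\<close> p(2)[of n] by (intro sum.mono_neutral_right) (auto simp flip: not_less)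
    also have "\<dots> = (\<Sum>i\<le>n. p n i * indicator C i)"
      by (auto simp: sum.inter_restrict indicator_def intro: sum.cong)
    finally have C: "(\<Sum>i\<le>n. p n i * indicator C i) = (\<Sum>i\<in>C. p n i)" by simp
    obtain s where "\<And>j. j \<le> n \<Longrightarrow> (\<Sum>i\<le>n. p n i * Q i j) = - (s * \<alpha> n $ j)"
      using p(4)[of n] by blast
    then have "(\<Sum>i\<le>n. p n i * d n i) = 0"
      unfolding d_def by (rule augmented_balance[of n \<alpha>, OF assms(3)])
    moreover have "(\<Sum>i\<le>n. h n i) =
        b' * (\<Sum>i\<le>n. p n i * indicator C i) - (\<Sum>i\<le>n. p n i) - (\<Sum>i\<le>n. p n i * d n i)"
      unfolding h_def sum_distrib_left sum_subtractf[symmetric]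
      by (intro sum.cong refl) (simp add: algebra_simps)
    ultimately show ?thesis by (simp add: C p)
  qed
  have h_sum_le: "sum (h n) F \<le> b' * (\<Sum>i\<in>C. p n i) - 1" if "finite F" for F n
    unfolding h_total[symmetric] by (rule sum_le[OF that h_nonneg]) (simp add: h_def p)
  obtain S where "0 \<le> S" and S: "\<And>i F. i \<notin> C \<Longrightarrow> finite F \<Longrightarrow> F \<subseteq> - C \<Longrightarrow>
      (\<Sum>j\<in>F. flow i j * max (v j - v i) 0) \<le> S * (rate i + 1)"
  proof -
    let ?f = "\<lambda>i j. ennreal (Q i j / (\<bar>Q i i\<bar> + 1) * max (v j - v i) 0)"
    obtain S where S: "0 \<le> S" "(SUP i \<in> - C. \<Sum>\<^sub>\<infinity>j \<in> - C. ?f i j) = ennreal S"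
      using increments[unfolded infinity_ennreal_def less_top_ennreal] by blast
    have "(\<Sum>j\<in>F. flow i j * max (v j - v i) 0) \<le> S * (rate i + 1)"
      if "i \<notin> C" "finite F" "F \<subseteq> - C" for i F
    proof -
      \<comment> \<open>On the diagonal the increment is zero, so \<open>Q\<close> may be replaced
        by \<open>flow\<close>.\<close>
      have eq: "Q i j / (\<bar>Q i i\<bar> + 1) * max (v j - v i) 0 = flow i j * max (v j - v i) 0 / (rate i + 1)" for j
        unfolding abs_Q by (simp add: Q_eq)
      have "ennreal ((\<Sum>j\<in>F. flow i j * max (v j - v i) 0) / (rate i + 1)) = (\<Sum>j\<in>F. ?f i j)"
        unfolding eq sum_divide_distrib
        by (subst sum_ennreal) (auto simp: flow_nonneg less_imp_le[OF rate_pos] add_nonneg_nonneg)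
      also have "\<dots> = infsum (?f i) F"
        using that by simp
      also have "\<dots> \<le> infsum (?f i) (- C)"
        using that by (intro infsum_mono_neutral nonneg_summable_on_complete) auto
      also have "\<dots> \<le> ennreal S"
        unfolding S(2)[symmetric] using that by (intro SUP_upper) auto
      finally show ?thesis
        using S(1) rate_pos[of i] by (simp add: pos_divide_le_eq)
    qed
    with S(1) that show ?thesis by blast
  qed

  \<comment> \<open>Every pointwise cluster point is \<open>\<pi>\<close>\<close>
  have cluster: "\<mu> i = \<pi> i"
    if r: "strict_mono r" and lim: "\<And>i. (\<lambda>n. p (r n) i) \<longlonglongrightarrow> \<mu> i" for r \<mu> i
  proof -
    have \<mu>: "0 \<le> \<mu> i" for i
      by (rule LIMSEQ_le_const[OF lim]) (auto intro: p)
    have bound_lim: "(\<lambda>n. b' * (\<Sum>i\<in>C. p (r n) i) - 1) \<longlonglongrightarrow> b' * (\<Sum>i\<in>C. \<mu> i) - 1"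
      by (intro tendsto_intros lim)
    have out: "(\<lambda>i. \<mu> i * rate i) summable_on UNIV"
    proof (rule infsum_Fatou(1)[OF _ _ _ bound_lim])
      show "(\<lambda>n. p (r n) i * rate i) \<longlonglongrightarrow> \<mu> i * rate i" for i
        by (intro tendsto_intros lim)
      show "\<forall>\<^sub>F n in sequentially. (\<Sum>i\<in>F. p (r n) i * rate i) \<le> b' * (\<Sum>i\<in>C. p (r n) i) - 1"
        if "finite F" for F
        using order_trans[OF sum_mono[OF h_ge] h_sum_le[OF that]] by (intro always_eventually) blast
    qed (simp add: p less_imp_le[OF rate_pos])
    have inflow: "(\<lambda>i. \<mu> i * flow i j) summable_on UNIV" "(\<Sum>\<^sub>\<infinity>i. \<mu> i * flow i j) \<le> \<mu> j * rate j" for j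
    proof -
      have 1: "(\<lambda>n. p (r n) i * flow i j) \<longlonglongrightarrow> \<mu> i * flow i j" for i
        by (intro tendsto_intros lim)
      have 2: "(\<lambda>n. p (r n) j * rate j) \<longlonglongrightarrow> \<mu> j * rate j"
        by (intro tendsto_intros lim)
      have 3: "\<forall>\<^sub>F n in sequentially. (\<Sum>i\<in>F. p (r n) i * flow i j) \<le> p (r n) j * rate j"
        if "finite F" for F
        using eventually_ge_at_top[of j]
        by eventually_elim (use order_trans[OF _ seq_suble[OF r]] in \<open>blast intro: inflow_le[OF that]\<close>)
      show "(\<lambda>i. \<mu> i * flow i j) summable_on UNIV" "(\<Sum>\<^sub>\<infinity>i. \<mu> i * flow i j) \<le> \<mu> j * rate j"
        using infsum_Fatou[OF _ 1 3 2] by (simp_all add: p flow_nonneg)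
    qed
    \<comment> \<open>The empty partial sum of \<open>h n\<close> already shows that mass at least
      \<open>1 / b'\<close> stays in the finite set \<open>C\<close>, so it survives in the limit
      and \<open>\<mu>\<close> is nonzero.\<close>
    have "0 \<le> b' * (\<Sum>i\<in>C. p n i) - 1" for n
      using h_sum_le[of "{}" n] by simp
    then have "0 \<le> b' * (\<Sum>i\<in>C. \<mu> i) - 1"
      by (intro LIMSEQ_le_const[OF bound_lim]) blast
    then have "(\<Sum>i\<in>C. \<mu> i) \<noteq> 0" by auto
    then obtain m where "\<mu> m \<noteq> 0"
      using sum.not_neutral_contains_not_neutral by blast
    then obtain k where k: "0 \<le> k" "\<And>i. \<pi> i = k * \<mu> i"
      using subinvariant_proportional[OF \<pi>_nonneg \<pi>(2) \<mu> out has_sum_infsum[OF inflow(1)] inflow(2)] by blast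
    then have "0 < k"
      using \<pi>(1)[of 0] by (cases "k = 0") auto
    define c where "c = 1 / k"
    have \<mu>_eq: "\<mu> i = c * \<pi> i" for i
      using \<open>0 < k\<close> by (simp add: c_def k(2))
    have \<mu>_has_sum: "(\<mu> has_sum c) UNIV"
      using has_sum_cmult_right[OF \<pi>_has_sum, of c] by (simp add: \<mu>_eq[symmetric])
    have "infsum \<mu> UNIV \<le> 1"
    proof (rule infsum_Fatou(2)[OF _ lim _ tendsto_const])
      show "\<forall>\<^sub>F n in sequentially. sum (p (r n)) F \<le> 1" if "finite F" for F
        using that by (simp add: p_sum_le)
    qed (rule p)
    then have "c \<le> 1"
      using infsumI[OF \<mu>_has_sum] by simp
    \<comment> \<open>Finite total outflow of \<open>\<pi>\<close> is obtained here, from that of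
      \<open>\<mu>\<close> by proportionality.\<close>
    have "(\<lambda>i. k * (\<mu> i * rate i)) summable_on UNIV"
      by (intro summable_on_cmult_right out)
    then have "(\<lambda>i. \<pi> i * rate i) summable_on UNIV"
      by (simp add: k(2) mult.assoc)
    moreover have "0 \<le> v i" for i
      using assms(6)[of i] by simp
    ultimately have "((\<lambda>i. \<pi> i * g i) has_sum 0) UNIV"
      unfolding g_def
      using stationary_drift_has_sum_zero[OF \<pi>_nonneg \<pi>(2) _ has_sum_imp_summable[OF \<pi>_has_sum] _ _ \<open>finite C\<close> \<open>0 \<le> S\<close> S]
        drift by blast
    from has_sum_cmult_right[OF this, of c]
    have g_sum: "((\<lambda>i. \<mu> i * g i) has_sum 0) UNIV"
      by (simp add: \<mu>_eq mult.assoc)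
    have C_sum: "((\<lambda>i. \<mu> i * indicator C i) has_sum (\<Sum>i\<in>C. \<mu> i)) UNIV"
      by (rule has_sum_finite_neutralI[OF \<open>finite C\<close>]) auto
    have "((\<lambda>i. b' * (\<mu> i * indicator C i) - \<mu> i - \<mu> i * g i) has_sum
        b' * (\<Sum>i\<in>C. \<mu> i) - c - 0) UNIV"
      by (intro has_sum_minus has_sum_cmult_right C_sum \<mu>_has_sum g_sum)
    moreover have "b' * (\<mu> i * indicator C i) - \<mu> i - \<mu> i * g i = \<mu> i * (b' * indicator C i - 1 - g i)" for i
      by (simp add: algebra_simps)
    ultimately have "(\<Sum>\<^sub>\<infinity>i. \<mu> i * (b' * indicator C i - 1 - g i)) = b' * (\<Sum>i\<in>C. \<mu> i) - c"
      by (simp add: infsumI)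
    \<comment> \<open>This detects lost mass: the totals of \<open>h (r n)\<close> subtract the full
      mass \<open>1\<close>, the limiting total subtracts only \<open>c\<close>, and the masses of
      \<open>C\<close> converge. Fatou then gives \<open>1 \<le> c\<close>.\<close>
    moreover have "(\<Sum>\<^sub>\<infinity>i. \<mu> i * (b' * indicator C i - 1 - g i)) \<le> b' * (\<Sum>i\<in>C. \<mu> i) - 1"
    proof (rule infsum_Fatou(2)[OF _ _ _ bound_lim])
      show "(\<lambda>n. h (r n) i) \<longlonglongrightarrow> \<mu> i * (b' * indicator C i - 1 - g i)" for i
      proof -
        have "(\<lambda>n. d (r n) i) \<longlonglongrightarrow> g i"
          using LIMSEQ_subseq_LIMSEQ[OF drift_lim r] unfolding d_def g_def comp_def .
        then show ?thesis
          unfolding h_def by (intro tendsto_intros lim)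
      qed
    qed (simp_all add: h_nonneg h_sum_le)
    ultimately have "1 \<le> c" by simp
    with \<open>c \<le> 1\<close> show ?thesis by (simp add: \<mu>_eq)
  qed

  \<comment> \<open>From cluster points to convergence in norm\<close>
  have "(\<lambda>n. p n i) \<longlonglongrightarrow> \<pi> i" for i
  proof (rule ccontr)
    assume "\<not> (\<lambda>n. p n i) \<longlonglongrightarrow> \<pi> i"
    then obtain \<epsilon> where \<epsilon>: "0 < \<epsilon>" "\<not> (\<forall>\<^sub>F n in sequentially. dist (p n i) (\<pi> i) < \<epsilon>)"
      by (auto simp: tendsto_iff)
    define N where "N = {n. \<not> dist (p n i) (\<pi> i) < \<epsilon>}"
    have "infinite N"
      using \<epsilon>(2) by (simp add: N_def cofinite_eq_sequentially[symmetric] eventually_cofinite)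
    \<comment> \<open>The sequence of bad indices has a pointwise convergent subsequence; its limit
      at \<open>i\<close> must be \<open>\<pi> i\<close>, although all its terms stay at distance at
      least \<open>\<epsilon>\<close> from it.\<close>
    define s where "s = enumerate N"
    have s: "strict_mono s" "s n \<in> N" for n
      using \<open>infinite N\<close> by (simp_all add: s_def strict_mono_enumerate enumerate_in_set)
    obtain r \<mu> where r: "strict_mono r" and lim: "\<And>i. (\<lambda>n. p (s (r n)) i) \<longlonglongrightarrow> \<mu> i"
      using pointwise_convergent_subsequence[of "\<lambda>n. p (s n)"] p(1) p_le by auto
    have "\<mu> i = \<pi> i"
      using cluster[OF strict_mono_o[OF s(1) r]] lim by simp
    then have "\<forall>\<^sub>F n in sequentially. dist (p (s (r n)) i) (\<pi> i) < \<epsilon>"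
      using lim[of i] \<epsilon>(1) by (simp add: tendsto_iff)
    then have "\<forall>\<^sub>F n in sequentially. False"
      by eventually_elim (use s(2) in \<open>auto simp: N_def\<close>)
    then show False by simp
  qed
  from Scheffe_l1[OF \<pi>_nonneg \<pi>(3) p(1) p_sums this]
  show ?thesis unfolding p_def .
qed

end
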